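(* Let $\mathcal{H}$ be a Hilbert space and let $F:\mathcal{B}(\mathbb{R})\to\mathcal{L}_s^+(\mathcal{H})$ be a normalized POVM which is absolutely continuous with respect to a finite measure $\nu$ on $\mathcal{B}(\mathbb{R})$. Then $F$ is uniformly continuous.
   Context: $\mathcal{B}(\mathbb{R})$ is the Borel $\sigma$-algebra of $\mathbb{R}$; $\mathcal{L}_s^+(\mathcal{H})$ is the set of positive bounded self-adjoint operators on $\mathcal{H}$. A POVM (semispectral measure) is a map $F:\mathcal{B}(\mathbb{R})\to\mathcal{L}_s^+(\mathcal{H})$ with $F(\bigcup_n\Delta_n)=\sum_nF(\Delta_n)$ for every countable family of pairwise disjoint Borel sets, the series converging in the weak operator topology. It is normalized if $F(\mathbb{R})=\mathbf{1}$ (the identity). $F$ is absolutely continuous with respect to a measure $\nu$ on $\mathcal{B}(\mathbb{R})$ if there is a positive number $c$ such that $\|F(\Delta)\|\le c\,\nu(\Delta)$ for each $\Delta\in\mathcal{B}(\mathbb{R})$. $F$ is uniformly continuous if for every sequence of pairwise disjoint Borel sets $\Delta_i$ with union $\Delta$ one has $\lim_{n\to\infty}\sum_{i=1}^nF(\Delta_i)=F(\Delta)$ in the operator norm topology. *)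

theory Defs
  imports "HOL-Analysis.Analysis"
begin

text \<open>
  A complex inner product space, built on top of the library's real normed spaces so that
  limits, completeness and the operator norm on the type of bounded linear maps are
  available. The inner product is antilinear in its first and linear in its second argument,
  and the norm is the one it induces (so the norm axioms inherited from
  \<^class>\<open>real_normed_vector\<close> impose no further restriction).
\<close>

class complex_inner = real_normed_vector +
  fixes scaleC :: "complex \<Rightarrow> 'a \<Rightarrow> 'a" (infixr "*\<^sub>C" 75)
    and cinner :: "'a \<Rightarrow> 'a \<Rightarrow> complex"
  assumes scaleC_add_right: "a *\<^sub>C (x + y) = a *\<^sub>C x + a *\<^sub>C y"
    and scaleC_add_left: "(a + b) *\<^sub>C x = a *\<^sub>C x + b *\<^sub>C x"
    and scaleC_scaleC: "a *\<^sub>C b *\<^sub>C x = (a * b) *\<^sub>C x"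
    and scaleC_of_real: "complex_of_real r *\<^sub>C x = r *\<^sub>R x"
    and cinner_commute: "cinner x y = cnj (cinner y x)"
    and cinner_add_right: "cinner x (y + z) = cinner x y + cinner x z"
    and cinner_scaleC_right: "cinner x (a *\<^sub>C y) = a * cinner x y"
    and cinner_ge_zero: "0 \<le> Re (cinner x x)"
    and cinner_eq_zero_iff: "cinner x x = 0 \<longleftrightarrow> x = 0"
    and norm_eq_sqrt_cinner: "norm x = sqrt (Re (cinner x x))"

class complex_hilbert = complex_inner + complete_space

instantiation complex :: complex_hilbert
begin

definition scaleC_complex :: "complex \<Rightarrow> complex \<Rightarrow> complex"
  where "scaleC_complex a x = a * x"

definition cinner_complex :: "complex \<Rightarrow> complex \<Rightarrow> complex"
  where "cinner_complex x y = cnj x * y"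

instance
  by standard
    (auto simp: scaleC_complex_def cinner_complex_def algebra_simps scaleR_conv_of_real
      cmod_def power2_eq_square)

end

text \<open>
  The type \<^typ>\<open>'a \<Rightarrow>\<^sub>L 'a\<close> consists of the bounded \<^emph>\<open>real\<close>-linear maps; complex linearity is
  therefore a separate condition. The norm on this type is the operator norm.
\<close>

definition complex_linear :: "('a::complex_inner \<Rightarrow>\<^sub>L 'a) \<Rightarrow> bool"
  where "complex_linear A \<longleftrightarrow> (\<forall>c x. blinfun_apply A (c *\<^sub>C x) = c *\<^sub>C blinfun_apply A x)"

definition selfadjoint :: "('a::complex_inner \<Rightarrow>\<^sub>L 'a) \<Rightarrow> bool"
  where "selfadjoint A \<longleftrightarrow>
    (\<forall>x y. cinner (blinfun_apply A x) y = cinner x (blinfun_apply A y))"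

text \<open>
  For self-adjoint \<open>A\<close> the number \<open>cinner x (A x)\<close> is real, so positivity only needs its
  real part.
\<close>

definition positive_selfadjoint_ops :: "('a::complex_inner \<Rightarrow>\<^sub>L 'a) set"
  where "positive_selfadjoint_ops =
    {A. complex_linear A \<and> selfadjoint A \<and> (\<forall>x. 0 \<le> Re (cinner x (blinfun_apply A x)))}"

definition wot_tendsto :: "(nat \<Rightarrow> 'a::complex_inner \<Rightarrow>\<^sub>L 'a) \<Rightarrow> ('a \<Rightarrow>\<^sub>L 'a) \<Rightarrow> bool"
  where "wot_tendsto T A \<longleftrightarrow>
    (\<forall>x y. (\<lambda>n. cinner x (blinfun_apply (T n) y)) \<longlonglongrightarrow> cinner x (blinfun_apply A y))"

text \<open>
  Operator-valued set functions are total on \<^typ>\<open>real set\<close>; only their values on Borel sets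
  matter. Finite families are covered by padding with empty sets: the constant sequence of
  empty sets forces \<open>F {} = 0\<close>.
\<close>

definition povm :: "(real set \<Rightarrow> ('a::complex_hilbert \<Rightarrow>\<^sub>L 'a)) \<Rightarrow> bool"
  where "povm F \<longleftrightarrow>
    (\<forall>\<Delta>\<in>sets borel. F \<Delta> \<in> positive_selfadjoint_ops) \<and>
    (\<forall>\<Delta> :: nat \<Rightarrow> real set. range \<Delta> \<subseteq> sets borel \<longrightarrow> disjoint_family \<Delta> \<longrightarrow>
      wot_tendsto (\<lambda>n. \<Sum>i<n. F (\<Delta> i)) (F (\<Union>i. \<Delta> i)))"

definition normalized_povm :: "(real set \<Rightarrow> ('a::complex_hilbert \<Rightarrow>\<^sub>L 'a)) \<Rightarrow> bool"
  where "normalized_povm F \<longleftrightarrow> povm F \<and> F UNIV = id_blinfun"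

definition povm_absolutely_continuous ::
    "(real set \<Rightarrow> ('a::complex_hilbert \<Rightarrow>\<^sub>L 'a)) \<Rightarrow> real measure \<Rightarrow> bool"
  where "povm_absolutely_continuous F \<nu> \<longleftrightarrow>
    (\<exists>c::real. c > 0 \<and>
      (\<forall>\<Delta>\<in>sets borel. ennreal (norm (F \<Delta>)) \<le> ennreal c * emeasure \<nu> \<Delta>))"

definition povm_uniformly_continuous ::
    "(real set \<Rightarrow> ('a::complex_hilbert \<Rightarrow>\<^sub>L 'a)) \<Rightarrow> bool"
  where "povm_uniformly_continuous F \<longleftrightarrow>
    (\<forall>\<Delta> :: nat \<Rightarrow> real set. range \<Delta> \<subseteq> sets borel \<longrightarrow> disjoint_family \<Delta> \<longrightarrow>
      (\<lambda>n. \<Sum>i<n. F (\<Delta> i)) \<longlonglongrightarrow> F (\<Union>i. \<Delta> i))"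

end

theory Submission imports Defs begin

text \<open>
  Finite additivity of \<open>F\<close> gives \<open>F \<Delta> - (\<Sum>i<n. F (\<Delta> i)) = F (\<Delta> - (\<Union>i<n. \<Delta> i))\<close>. By absolute
  continuity the norm of the right-hand side is at most \<open>c\<close> times the \<open>\<nu>\<close>-measure of the tails,
  which decrease to the empty set, so it tends to \<open>0\<close> because \<open>\<nu>\<close> is finite.
\<close>

text \<open>Scalar limits are unique, so \<open>A y\<close> and \<open>B y\<close> have the same
  inner product with every vector; testing against \<open>A y - B y\<close> itself and using
  definiteness gives equality. This is what turns weak additivity into identities between
  operators.\<close>

lemma wot_tendsto_unique:
  fixes T :: "nat \<Rightarrow> ('a::complex_inner \<Rightarrow>\<^sub>L 'a)"
  assumes "wot_tendsto T A" "wot_tendsto T B"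
  shows "A = B"
proof (rule blinfun_eqI)
  fix y
  have eq: "cinner x (A y) = cinner x (B y)" for x
    using assms LIMSEQ_unique unfolding wot_tendsto_def by blast
  \<comment> \<open>Subtractivity in the second argument, obtained from additivity applied to
    \<open>(A y - B y) + B y\<close>.\<close>
  have "cinner x (A y - B y) + cinner x (B y) = cinner x (A y)" for x
    by (metis cinner_add_right diff_add_cancel)
  then have "cinner (A y - B y) (A y - B y) = 0"
    using eq[of "A y - B y"] by (metis add_cancel_left_left)
  then show "A y = B y"
    by (simp add: cinner_eq_zero_iff)
qed

lemma wot_tendsto_eventually_const:
  assumes "\<And>n. n \<ge> N \<Longrightarrow> T n = A"
  shows "wot_tendsto T A"
  unfolding wot_tendsto_def
proof (intro allI tendsto_eventually)
  fix x y
  show "\<forall>\<^sub>F n in sequentially. cinner x (T n y) = cinner x (A y)"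
    using assms by (auto simp: eventually_sequentially)
qed

text \<open>Countable additivity is applied to the sequence \<open>A\<close>, \<open>B\<close>,
  \<open>{}\<close>, \<open>{}\<close>, ... Since \<open>F {} = 0\<close>, its partial sums are
  constant from \<open>n = 2\<close> on, so \<open>F A + F B\<close> is a weak limit of them as
  well, and weak limits are unique.\<close>

lemma povm_Un:
  assumes "povm F" and F0: "F {} = 0"
    and "A \<in> sets borel" "B \<in> sets borel" "A \<inter> B = {}"
  shows "F (A \<union> B) = F A + F B"
proof (rule wot_tendsto_unique)
  have "range (binaryset A B) \<subseteq> sets borel" "disjoint_family (binaryset A B)"
    using assms by (auto simp: range_binaryset_eq disjoint_family_on_def binaryset_def)
  then show "wot_tendsto (\<lambda>n. \<Sum>i<n. F (binaryset A B i)) (F (A \<union> B))"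
    using \<open>povm F\<close> unfolding povm_def by (metis UN_binaryset_eq)
  show "wot_tendsto (\<lambda>n. \<Sum>i<n. F (binaryset A B i)) (F A + F B)"
  proof (rule wot_tendsto_eventually_const)
    fix n :: nat assume "2 \<le> n"
    then have "(\<Sum>i<n. F (binaryset A B i)) = (\<Sum>i<2. F (binaryset A B i))"
      by (intro sum.mono_neutral_right) (auto simp: binaryset_def F0)
    then show "(\<Sum>i<n. F (binaryset A B i)) = F A + F B"
      by (simp add: binaryset_def numeral_2_eq_2)
  qed
qed

lemma povm_UN_lessThan:
  fixes \<Delta> :: "nat \<Rightarrow> real set"
  assumes "povm F" "F {} = 0" and "range \<Delta> \<subseteq> sets borel" "disjoint_family \<Delta>"
  shows "F (\<Union>i<n. \<Delta> i) = (\<Sum>i<n. F (\<Delta> i))"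
proof (induction n)
  case 0
  then show ?case by (simp add: assms)
next
  case (Suc n)
  have "(\<Union>i<n. \<Delta> i) \<inter> \<Delta> n = {}"
    using disjoint_family_onD[OF assms(4), of _ n] by (blast dest: less_imp_neq)
  then have "F ((\<Union>i<n. \<Delta> i) \<union> \<Delta> n) = F (\<Union>i<n. \<Delta> i) + F (\<Delta> n)"
    using assms(3) by (intro povm_Un[OF assms(1,2)]) auto
  then show ?case
    using Suc by (simp add: lessThan_Suc Un_commute)
qed

theorem theorem6p2:
  fixes F :: "real set \<Rightarrow> ('a::complex_hilbert \<Rightarrow>\<^sub>L 'a)"
    and \<nu> :: "real measure"
  assumes "normalized_povm F"
    and "sets \<nu> = sets borel"
    and "finite_measure \<nu>"
    and "povm_absolutely_continuous F \<nu>"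
  shows "povm_uniformly_continuous F"
  unfolding povm_uniformly_continuous_def
proof (intro allI impI)
  fix \<Delta> :: "nat \<Rightarrow> real set"
  assume \<Delta>: "range \<Delta> \<subseteq> sets borel" "disjoint_family \<Delta>"
  interpret finite_measure \<nu> by fact
  have povm: "povm F"
    using assms(1) by (simp add: normalized_povm_def)
  obtain c where c: "c > 0"
    "\<And>A. A \<in> sets borel \<Longrightarrow> ennreal (norm (F A)) \<le> ennreal c * emeasure \<nu> A"
    using assms(4) unfolding povm_absolutely_continuous_def by blast
  \<comment> \<open>As \<nu> is finite, the bound in \<open>ennreal\<close> becomes one between real
    numbers.\<close>
  have bound: "norm (F A) \<le> c * measure \<nu> A" if "A \<in> sets borel" for A
  proof -
    have "ennreal (norm (F A)) \<le> ennreal (c * measure \<nu> A)"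
      using c(2)[OF that] c(1) by (simp add: emeasure_eq_measure ennreal_mult)
    then show ?thesis
      using c(1) by simp
  qed
  \<comment> \<open>Read off from absolute continuity, as \<nu> vanishes on the empty set; no limit
    argument is involved.\<close>
  have F0: "F {} = 0"
    using bound[of "{}"] by simp
  define R where "R n = (\<Union>i. \<Delta> i) - (\<Union>i<n. \<Delta> i)" for n
  have R: "R n \<in> sets borel" for n
    using \<Delta>(1) unfolding R_def by auto
  have diff: "F (\<Union>i. \<Delta> i) - (\<Sum>i<n. F (\<Delta> i)) = F (R n)" for n
  proof -
    have "F ((\<Union>i<n. \<Delta> i) \<union> R n) = F (\<Union>i<n. \<Delta> i) + F (R n)"
      using \<Delta>(1) R by (intro povm_Un[OF povm F0]) (auto simp: R_def)
    moreover have "(\<Union>i<n. \<Delta> i) \<union> R n = (\<Union>i. \<Delta> i)"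
      by (auto simp: R_def)
    ultimately show ?thesis
      by (simp add: povm_UN_lessThan[OF povm F0 \<Delta>])
  qed
  have "(\<lambda>n. measure \<nu> (R n)) \<longlonglongrightarrow> measure \<nu> (\<Inter>n. R n)"
    using R assms(2) by (intro finite_Lim_measure_decseq) (auto simp: R_def decseq_def)
  \<comment> \<open>A point of \<open>\<Delta> k\<close> is missing from \<open>R (Suc k)\<close>,
    and every point of \<open>R 0\<close> lies in some \<open>\<Delta> k\<close>.\<close>
  moreover have "(\<Inter>n. R n) = {}"
    unfolding R_def by fastforce
  ultimately have "(\<lambda>n. c * measure \<nu> (R n)) \<longlonglongrightarrow> 0"
    by (auto intro: tendsto_mult_right_zero)
  then have "(\<lambda>n. F (R n)) \<longlonglongrightarrow> 0"
    by (rule Lim_null_comparison[rotated]) (simp add: bound R)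
  \<comment> \<open>By \<open>diff\<close>, the left-hand side is exactly the \<open>n\<close>-th
    partial sum.\<close>
  then have "(\<lambda>n. F (\<Union>i. \<Delta> i) - F (R n)) \<longlonglongrightarrow> F (\<Union>i. \<Delta> i) - 0"
    by (intro tendsto_intros)
  then show "(\<lambda>n. \<Sum>i<n. F (\<Delta> i)) \<longlonglongrightarrow> F (\<Union>i. \<Delta> i)"
    unfolding diff[symmetric] by simp
qed

end
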